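(* Over two-values domains ($\Theta_i=\{L,H\}$ for every agent $i$, with $L<H$), there is a strongly bribeproof $\left(\frac12\right)$-linear mechanism $(A,p)$ satisfying min-max fairness for allocating a perfectly divisible item, where min-max fairness means $A(\theta)\in\arg\min_{a\in\mathcal{A}}\max_{i\in N}\{a_i\theta_i\}$ for all $\theta\in\Theta$.
   Context: Agents $N=\{1,\dots,n\}$, $n\ge 2$. The set of feasible allocations of a perfectly divisible item is $\mathcal{A}=\{a\in\mathbb{R}^n: a_i\ge 0,\ \sum_{i=1}^n a_i=1\}$. Agent $i$ has private type $\theta_i\in\Theta_i$ and her cost for $a$ is $a_i\theta_i$. $\Theta=\Theta_1\times\cdots\times\Theta_n$. A mechanism is a pair $(A,p)$ with $A:\Theta\to\mathcal{A}$ and payments $p:\Theta\to\mathbb{R}^n$ to the agents. A $\left(\frac12\right)$-linear mechanism has $p_i(\theta)=A_i(\theta)\,\frac{L+H}{2}+f_i$ for all $i$ and $\theta$, with constants $f_i$. $(A,p)$ is strongly bribeproof if for all $\theta\in\Theta$, all $i$ and $j$ in $N$, and all $\hat\theta\in\Theta$ obtained from $\theta$ by replacing the $i$-th entry, or both the $i$-th and the $j$-th entries, by arbitrary elements of $\Theta_i$ and $\Theta_j$ respectively, $$p_i(\theta)-A_i(\theta)\theta_i+p_j(\theta)-A_j(\theta)\theta_j\ge p_i(\hat\theta)-A_i(\hat\theta)\theta_i+p_j(\hat\theta)-A_j(\hat\theta)\theta_j$$ (the case $i=j$ amounts to strategyproofness).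
   Formalization: The formal statement adds the assumption H ≥ 0: for L < H < 0 the min-max fair allocation is unique, proportional to 1/|θ_i|, so a type-L agent gains by declaring H under half-linear payments and the claim is false; every case with H ≥ 0 is covered. *)

theory Defs
  imports "HOL-Analysis.Analysis"
begin

(* Agents are the elements of a finite type 'n, so that n = CARD('n) and profiles of
   types, allocations and payments are vectors of type real ^ 'n.  Mechanisms are total
   functions on real ^ 'n; only their values on the set D of type profiles matter. *)

definition allocations :: "(real ^ 'n::finite) set" where
  "allocations = {a. (\<forall>i. a $ i \<ge> 0) \<and> (\<Sum>i\<in>UNIV. a $ i) = 1}"

definition type_profiles :: "('n::finite \<Rightarrow> real set) \<Rightarrow> (real ^ 'n) set" where
  "type_profiles T = {\<theta>. \<forall>i. \<theta> $ i \<in> T i}"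

(* The entries of a profile are costs per unit.  Nothing is assumed here about their sign, but
   when L < H < 0 the unique min-max fair allocation gives an agent more for declaring H than for
   declaring L, and then half-linear payments are not strategyproof.  The existence claim is
   therefore stated for 0 <= H, which covers nonnegative costs. *)
definition two_values_profiles :: "real \<Rightarrow> real \<Rightarrow> (real ^ 'n::finite) set" where
  "two_values_profiles L H = type_profiles (\<lambda>i. {L, H})"

type_synonym 'n allocation_rule = "real ^ 'n \<Rightarrow> real ^ 'n"
type_synonym 'n payment_rule = "real ^ 'n \<Rightarrow> real ^ 'n"

definition mechanism ::
  "(real ^ 'n::finite) set \<Rightarrow> 'n allocation_rule \<Rightarrow> 'n payment_rule \<Rightarrow> bool" where
  "mechanism D A p \<longleftrightarrow> (\<forall>\<theta>\<in>D. A \<theta> \<in> allocations)"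

definition half_linear ::
  "real \<Rightarrow> real \<Rightarrow> (real ^ 'n::finite) set \<Rightarrow> 'n allocation_rule \<Rightarrow> 'n payment_rule \<Rightarrow> bool" where
  "half_linear L H D A p \<longleftrightarrow>
    (\<exists>f :: real ^ 'n. \<forall>\<theta>\<in>D. \<forall>i. p \<theta> $ i = A \<theta> $ i * ((L + H) / 2) + f $ i)"

(* Utility of agent i with true cost t per unit when the reported profile is r. *)
definition utility ::
  "'n allocation_rule \<Rightarrow> 'n payment_rule \<Rightarrow> 'n::finite \<Rightarrow> real \<Rightarrow> real ^ 'n \<Rightarrow> real" where
  "utility A p i t r = p r $ i - A r $ i * t"

(* The profile r arises from \<theta> by replacing entries i and j, possibly by themselves; this
   includes changing the i-th entry alone and the case i = j. *)
definition strongly_bribeproof ::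
  "(real ^ 'n::finite) set \<Rightarrow> 'n allocation_rule \<Rightarrow> 'n payment_rule \<Rightarrow> bool" where
  "strongly_bribeproof D A p \<longleftrightarrow>
    (\<forall>\<theta>\<in>D. \<forall>i j. \<forall>r\<in>D. (\<forall>k. k \<noteq> i \<and> k \<noteq> j \<longrightarrow> r $ k = \<theta> $ k) \<longrightarrow>
      utility A p i (\<theta> $ i) \<theta> + utility A p j (\<theta> $ j) \<theta>
      \<ge> utility A p i (\<theta> $ i) r + utility A p j (\<theta> $ j) r)"

definition min_max_fair :: "(real ^ 'n::finite) set \<Rightarrow> 'n allocation_rule \<Rightarrow> bool" where
  "min_max_fair D A \<longleftrightarrow>
    (\<forall>\<theta>\<in>D. is_arg_min (\<lambda>a. MAX i. a $ i * \<theta> $ i) (\<lambda>a. a \<in> allocations) (A \<theta>))"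

end

(* With half-linear payments an agent of type L (resp. H) gains (H - L)/2 (resp. loses
   (H - L)/2) per unit received.  So a pair of equal types only cares about its total share, and a
   pair of different types about the difference of its shares.  Split the item in proportion to
   weights x for type L and y for type H, where 0 <= y < x: reporting L raises the share of a
   coalition, hence truth is optimal for a pair of equal types; and for a low i and a high j the
   difference of shares is positive only if i reports L and j reports H.  Weights 1/L and 1/H
   equalise all costs and give min-max fairness when L > 0; for L <= 0 the limit weights 1 and 0
   do, with the equal split at the profile where all weights vanish. *)

theory Submission
  imports Defs
begin

section \<open>Sharing in proportion to weights\<close>

definition proportional_share :: "('n::finite \<Rightarrow> real) \<Rightarrow> 'n \<Rightarrow> real" where
  "proportional_share w i =
    (if sum w UNIV = 0 then 1 / real CARD('n) else w i / sum w UNIV)"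

lemma sum_proportional_share:
  fixes w :: "'n::finite \<Rightarrow> real"
  shows "sum (proportional_share w) I =
    (if sum w UNIV = 0 then real (card I) / real CARD('n) else sum w I / sum w UNIV)"
  by (simp add: proportional_share_def sum_divide_distrib)

lemma sum_proportional_share_UNIV:
  fixes w :: "'n::finite \<Rightarrow> real"
  shows "sum (proportional_share w) UNIV = 1"
  by (simp add: sum_proportional_share)

lemma proportional_share_nonneg:
  assumes "\<And>k. 0 \<le> w k"
  shows "0 \<le> proportional_share w i"
  using assms by (simp add: proportional_share_def sum_nonneg)

lemma proportional_share_mono:
  assumes "w i \<le> w j" "\<And>k. 0 \<le> w k"
  shows "proportional_share w i \<le> proportional_share w j"
  using assms by (simp add: proportional_share_def divide_right_mono sum_nonneg)

text \<open>With the outside weight \<open>R\<close> fixed, a coalition of weight \<open>W\<close>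
  receives \<open>W / (W + R)\<close>, which does not decrease in \<open>W\<close>. This is what
  makes joint misreports of equal types unprofitable.\<close>

lemma sum_proportional_share_mono:
  fixes w w' :: "'n::finite \<Rightarrow> real"
  assumes nonneg: "\<And>k. 0 \<le> w k"
    and le: "\<And>k. k \<in> I \<Longrightarrow> w k \<le> w' k"
    and eq: "\<And>k. k \<notin> I \<Longrightarrow> w' k = w k"
  shows "sum (proportional_share w) I \<le> sum (proportional_share w') I"
proof -
  define R where "R = sum w (- I)"
  have split: "sum v UNIV = sum v I + sum v (- I)" for v :: "'n \<Rightarrow> real"
    using sum.subset_diff[of I UNIV v] by (simp add: Compl_eq_Diff_UNIV)
  have S: "sum w UNIV = sum w I + R" using split[of w] by (simp add: R_def)
  have "sum w' (- I) = R" unfolding R_def by (rule sum.cong) (auto simp: eq)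
  then have S': "sum w' UNIV = sum w' I + R" using split[of w'] by simp
  have R: "0 \<le> R" unfolding R_def by (simp add: nonneg sum_nonneg)
  have W: "0 \<le> sum w I" by (simp add: nonneg sum_nonneg)
  have WW': "sum w I \<le> sum w' I" by (rule sum_mono) (simp add: le)
  have card: "real (card I) / real CARD('n) \<le> 1"
    by (simp add: card_mono)
  consider "sum w' I + R = 0" | "sum w I + R = 0" "sum w' I + R \<noteq> 0" | "0 < sum w I + R"
    using R W by linarith
  then show ?thesis
  proof cases
    case 1
    then have "sum w I + R = 0" using R W WW' by linarith
    with 1 show ?thesis by (simp add: sum_proportional_share S S')
  next
    case 2
    \<comment> \<open>Nobody outside \<open>I\<close> has weight, so under \<open>w'\<close> the
      coalition takes the whole item; under \<open>w\<close> it had the equal-split share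
      \<open>card I / CARD('n)\<close>, at most 1.\<close>
    then have "R = 0" using R W by linarith
    with 2 card show ?thesis by (simp add: sum_proportional_share S S')
  next
    case 3
    \<comment> \<open>After cross-multiplication, the products of the two coalition weights cancel
      and exactly this inequality remains.\<close>
    have "sum w I * R \<le> sum w' I * R" using WW' R by (rule mult_right_mono)
    then have "sum w I / (sum w I + R) \<le> sum w' I / (sum w' I + R)"
      using 3 WW' by (simp add: frac_le_eq divide_simps algebra_simps)
    with 3 WW' show ?thesis by (simp add: sum_proportional_share S S')
  qed
qed

section \<open>The two-weight rule and its payments\<close>

definition type_weight :: "real \<Rightarrow> real \<Rightarrow> real \<Rightarrow> real ^ 'n \<Rightarrow> 'n \<Rightarrow> real" where
  "type_weight L x y \<theta> k = (if \<theta> $ k = L then x else y)"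

definition proportional_rule :: "real \<Rightarrow> real \<Rightarrow> real \<Rightarrow> 'n::finite allocation_rule" where
  "proportional_rule L x y \<theta> = (\<chi> i. proportional_share (type_weight L x y \<theta>) i)"

text \<open>The constants \<open>f\<close> are taken to be 0; any others would cancel in every
  comparison of utilities.\<close>

definition half_linear_payment :: "real \<Rightarrow> real \<Rightarrow> 'n allocation_rule \<Rightarrow> 'n::finite payment_rule" where
  "half_linear_payment L H A \<theta> = (\<chi> i. A \<theta> $ i * ((L + H) / 2))"

lemma half_linear_half_linear_payment: "half_linear L H D A (half_linear_payment L H A)"
  unfolding half_linear_def half_linear_payment_def by (intro exI[of _ 0]) simp

lemma utility_half_linear_payment:
  "utility A (half_linear_payment L H A) i t r = A r $ i * ((L + H) / 2 - t)"
  by (simp add: utility_def half_linear_payment_def algebra_simps)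

lemma mem_two_values_profilesD:
  "\<theta> \<in> two_values_profiles L H \<Longrightarrow> \<theta> $ k = L \<or> \<theta> $ k = H"
  by (auto simp: two_values_profiles_def type_profiles_def)

lemma proportional_rule_allocation:
  assumes "0 \<le> y" "y < x"
  shows "proportional_rule L x y \<theta> \<in> allocations"
  using assms sum_proportional_share_UNIV
  by (auto simp: allocations_def proportional_rule_def type_weight_def
      intro!: proportional_share_nonneg)

section \<open>Strong bribeproofness\<close>

lemma proportional_rule_exchange:
  fixes \<theta> r :: "real ^ 'n::finite"
  assumes y: "0 \<le> y" and yx: "y < x"
    and i: "\<theta> $ i = L" and j: "\<theta> $ j \<noteq> L" "r $ j = L \<or> r $ j = \<theta> $ j"
    and r: "\<And>k. k \<noteq> i \<Longrightarrow> k \<noteq> j \<Longrightarrow> r $ k = \<theta> $ k"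
  shows "proportional_rule L x y r $ i - proportional_rule L x y r $ j
    \<le> proportional_rule L x y \<theta> $ i - proportional_rule L x y \<theta> $ j"
proof (cases "r $ i = L \<and> r $ j \<noteq> L")
  case True
  \<comment> \<open>The premise on \<open>r $ j\<close> stands in for a two-valued domain: a report
    of \<open>j\<close> other than \<open>L\<close> must be the truth.\<close>
  have "r $ k = \<theta> $ k" for k
    using True i j r by (cases "k = i"; cases "k = j") auto
  then have "r = \<theta>" by (simp add: vec_eq_iff)
  then show ?thesis by simp
next
  case False
  \<comment> \<open>Either \<open>i\<close> does not report \<open>L\<close> and has the smaller
    weight \<open>y\<close>, or \<open>j\<close> reports \<open>L\<close> and has the larger weight
    \<open>x\<close>. So the difference is at most 0 under \<open>r\<close>, whereas under
    \<open>\<theta>\<close> it is at least 0.\<close>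
  have "proportional_share (type_weight L x y r) i \<le> proportional_share (type_weight L x y r) j"
    using False y yx by (intro proportional_share_mono) (auto simp: type_weight_def)
  moreover have "proportional_share (type_weight L x y \<theta>) j
      \<le> proportional_share (type_weight L x y \<theta>) i"
    using i y yx by (intro proportional_share_mono) (auto simp: type_weight_def)
  ultimately show ?thesis by (simp add: proportional_rule_def)
qed

text \<open>Truth gives every member of an all-low coalition the largest weight \<open>x\<close>,
  and every member of a coalition without low types the smallest weight \<open>y\<close>. Both parts
  are therefore the same monotonicity, with \<open>\<theta>\<close> and \<open>r\<close>
  exchanged.\<close>

lemma proportional_rule_coalition:
  fixes \<theta> r :: "real ^ 'n::finite"
  assumes y: "0 \<le> y" and yx: "y < x" and r: "\<And>k. k \<notin> I \<Longrightarrow> r $ k = \<theta> $ k"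
  shows "(\<And>k. k \<in> I \<Longrightarrow> \<theta> $ k = L) \<Longrightarrow>
      (\<Sum>k\<in>I. proportional_rule L x y r $ k) \<le> (\<Sum>k\<in>I. proportional_rule L x y \<theta> $ k)"
    and "(\<And>k. k \<in> I \<Longrightarrow> \<theta> $ k \<noteq> L) \<Longrightarrow>
      (\<Sum>k\<in>I. proportional_rule L x y \<theta> $ k) \<le> (\<Sum>k\<in>I. proportional_rule L x y r $ k)"
proof -
  have "sum (proportional_share (type_weight L x y r)) I
      \<le> sum (proportional_share (type_weight L x y \<theta>)) I" if "\<And>k. k \<in> I \<Longrightarrow> \<theta> $ k = L"
    using that y yx r by (intro sum_proportional_share_mono) (auto simp: type_weight_def)
  then show "(\<And>k. k \<in> I \<Longrightarrow> \<theta> $ k = L) \<Longrightarrow>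
      (\<Sum>k\<in>I. proportional_rule L x y r $ k) \<le> (\<Sum>k\<in>I. proportional_rule L x y \<theta> $ k)"
    by (simp add: proportional_rule_def)
  have "sum (proportional_share (type_weight L x y \<theta>)) I
      \<le> sum (proportional_share (type_weight L x y r)) I" if "\<And>k. k \<in> I \<Longrightarrow> \<theta> $ k \<noteq> L"
    using that y yx r by (intro sum_proportional_share_mono) (auto simp: type_weight_def)
  then show "(\<And>k. k \<in> I \<Longrightarrow> \<theta> $ k \<noteq> L) \<Longrightarrow>
      (\<Sum>k\<in>I. proportional_rule L x y \<theta> $ k) \<le> (\<Sum>k\<in>I. proportional_rule L x y r $ k)"
    by (simp add: proportional_rule_def)
qed

lemma strongly_bribeproof_proportional_rule:
  fixes L H x y :: real
  defines "A \<equiv> (proportional_rule L x y :: 'n::finite allocation_rule)"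
  assumes LH: "L < H" and y: "0 \<le> y" and yx: "y < x"
  shows "strongly_bribeproof (two_values_profiles L H) A (half_linear_payment L H A)"
  unfolding strongly_bribeproof_def utility_half_linear_payment
proof (intro ballI allI impI)
  fix \<theta> r :: "real ^ 'n" and i j
  assume \<theta>: "\<theta> \<in> two_values_profiles L H" and rD: "r \<in> two_values_profiles L H"
    and r: "\<forall>k. k \<noteq> i \<and> k \<noteq> j \<longrightarrow> r $ k = \<theta> $ k"
  define d where "d = (H - L) / 2"
  have d: "0 < d" using LH by (simp add: d_def)
  have gain: "(L + H) / 2 - L = d" "(L + H) / 2 - H = - d" by (simp_all add: d_def field_simps)
  let ?goal = "\<lambda>\<theta> r i j. A r $ i * ((L + H) / 2 - \<theta> $ i) + A r $ j * ((L + H) / 2 - \<theta> $ j)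
      \<le> A \<theta> $ i * ((L + H) / 2 - \<theta> $ i) + A \<theta> $ j * ((L + H) / 2 - \<theta> $ j)"
  have vals: "\<theta> $ k = L \<or> \<theta> $ k = H" "r $ k = L \<or> r $ k = H" for k
    using mem_two_values_profilesD \<theta> rD by blast+
  \<comment> \<open>For \<open>i = j\<close> the set is a singleton while the bribeproofness
    inequality counts the agent twice; the single-share inequality is then doubled.\<close>
  have pair: "(\<Sum>k\<in>{i, j}. v $ k) = (if i = j then v $ i else v $ i + v $ j)" for v :: "real ^ 'n"
    by simp
  \<comment> \<open>Stated for either order of the pair, since the low agent may be \<open>i\<close>
    or \<open>j\<close>.\<close>
  have exchange: "?goal \<theta> r i' j'"
    if "{i', j'} = {i, j}" "\<theta> $ i' = L" "\<theta> $ j' = H" for i' j'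
  proof -
    have "A r $ i' - A r $ j' \<le> A \<theta> $ i' - A \<theta> $ j'"
      unfolding A_def
      by (rule proportional_rule_exchange[OF y yx]) (use that LH vals r in auto)
    then have "(A r $ i' - A r $ j') * d \<le> (A \<theta> $ i' - A \<theta> $ j') * d"
      using d by (simp add: mult_right_mono)
    then show ?thesis unfolding that gain by (simp add: algebra_simps)
  qed
  consider "\<theta> $ i = L" "\<theta> $ j = L" | "\<theta> $ i = H" "\<theta> $ j = H"
    | "\<theta> $ i = L" "\<theta> $ j = H" | "\<theta> $ j = L" "\<theta> $ i = H"
    using vals by blast
  then show "?goal \<theta> r i j"
  proof cases
    case 1
    have "(\<Sum>k\<in>{i, j}. A r $ k) \<le> (\<Sum>k\<in>{i, j}. A \<theta> $ k)"
      unfolding A_def by (rule proportional_rule_coalition(1)[OF y yx]) (use 1 r in auto)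
    then have "A r $ i + A r $ j \<le> A \<theta> $ i + A \<theta> $ j"
      unfolding pair by (auto split: if_splits)
    then have "(A r $ i + A r $ j) * d \<le> (A \<theta> $ i + A \<theta> $ j) * d"
      using d by (simp add: mult_right_mono)
    then show ?thesis unfolding 1 gain by (simp add: algebra_simps)
  next
    case 2
    have "(\<Sum>k\<in>{i, j}. A \<theta> $ k) \<le> (\<Sum>k\<in>{i, j}. A r $ k)"
      unfolding A_def by (rule proportional_rule_coalition(2)[OF y yx]) (use 2 r LH in auto)
    then have "A \<theta> $ i + A \<theta> $ j \<le> A r $ i + A r $ j"
      unfolding pair by (auto split: if_splits)
    then have "(A \<theta> $ i + A \<theta> $ j) * d \<le> (A r $ i + A r $ j) * d"
      using d by (simp add: mult_right_mono)
    then show ?thesis unfolding 2 gain by (simp add: algebra_simps)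
  next
    case 3
    then show ?thesis by (intro exchange) auto
  next
    case 4
    then have "?goal \<theta> r j i" by (intro exchange) auto
    then show ?thesis by (simp add: add.commute)
  qed
qed

section \<open>Min-max fairness\<close>

text \<open>A threshold \<open>m\<close> between the maximal cost of \<open>a\<close> and that of
  every rival certifies optimality.\<close>

lemma is_arg_min_max_costI:
  fixes a \<theta> :: "real ^ 'n::finite"
  assumes "a \<in> allocations" and le: "\<And>i. a $ i * \<theta> $ i \<le> m"
    and ge: "\<And>b. b \<in> allocations \<Longrightarrow> \<exists>i. m \<le> b $ i * \<theta> $ i"
  shows "is_arg_min (\<lambda>a. MAX i. a $ i * \<theta> $ i) (\<lambda>a. a \<in> allocations) a"
proof -
  have "(MAX i. a $ i * \<theta> $ i) \<le> (MAX i. b $ i * \<theta> $ i)" if b: "b \<in> allocations" for b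
  proof -
    obtain i where "m \<le> b $ i * \<theta> $ i" using ge[OF b] by blast
    also have "\<dots> \<le> (MAX i. b $ i * \<theta> $ i)" by simp
    finally have "m \<le> (MAX i. b $ i * \<theta> $ i)" .
    moreover have "(MAX i. a $ i * \<theta> $ i) \<le> m" using le by simp
    ultimately show ?thesis by linarith
  qed
  then show ?thesis using assms(1) unfolding is_arg_min_def by (meson not_le)
qed

text \<open>Both vectors sum to 1, so neither can exceed the other in every entry.\<close>

lemma ex_ge_of_allocations:
  fixes a b :: "real ^ 'n::finite"
  assumes "a \<in> allocations" "b \<in> allocations"
  shows "\<exists>i. a $ i \<le> b $ i"
proof (rule ccontr)
  assume "\<not> ?thesis"
  then have "(\<Sum>i\<in>UNIV. b $ i) < (\<Sum>i\<in>UNIV. a $ i)"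
    by (intro sum_strict_mono) (auto simp: not_le)
  then show False using assms by (simp add: allocations_def)
qed

lemma min_max_fair_inverse_weights:
  fixes L H :: real
  assumes L: "0 < L" and LH: "L < H"
  shows "min_max_fair (two_values_profiles L H)
    (proportional_rule L (1 / L) (1 / H) :: 'n::finite allocation_rule)"
  unfolding min_max_fair_def
proof
  fix \<theta> :: "real ^ 'n"
  assume \<theta>: "\<theta> \<in> two_values_profiles L H"
  define w where "w = type_weight L (1 / L) (1 / H) \<theta>"
  define a where "a = proportional_rule L (1 / L) (1 / H) \<theta>"
  have a: "a \<in> allocations" unfolding a_def
    by (rule proportional_rule_allocation) (use L LH in \<open>auto simp: field_simps\<close>)
  have pos: "0 < \<theta> $ i" for i using mem_two_values_profilesD[OF \<theta>, of i] L LH by auto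
  have w: "w i = 1 / \<theta> $ i" for i
    using mem_two_values_profilesD[OF \<theta>, of i] LH by (auto simp: w_def type_weight_def)
  have S: "0 < sum w UNIV" by (rule sum_pos) (auto simp: w pos)
  \<comment> \<open>Each weight times its own type is 1, so all agents bear the same cost. A rival
    gives some agent at least as large a share, hence at least this cost, as types are
    positive.\<close>
  have cost: "a $ i * \<theta> $ i = 1 / sum w UNIV" for i
    using S pos[of i] unfolding a_def proportional_rule_def w_def[symmetric]
    by (simp add: proportional_share_def w)
  show "is_arg_min (\<lambda>a. MAX i. a $ i * \<theta> $ i) (\<lambda>a. a \<in> allocations)
      (proportional_rule L (1 / L) (1 / H) \<theta>)"
    unfolding a_def[symmetric]
  proof (rule is_arg_min_max_costI[OF a])
    show "a $ i * \<theta> $ i \<le> 1 / sum w UNIV" for i using cost by simp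
    fix b :: "real ^ 'n"
    assume "b \<in> allocations"
    then obtain i where "a $ i \<le> b $ i" using ex_ge_of_allocations[OF a] by blast
    then have "a $ i * \<theta> $ i \<le> b $ i * \<theta> $ i" using pos[of i] by (simp add: mult_right_mono)
    then show "\<exists>i. 1 / sum w UNIV \<le> b $ i * \<theta> $ i" using cost by metis
  qed
qed

lemma min_max_fair_indicator_weights:
  fixes L H :: real
  assumes L: "L \<le> 0" and LH: "L < H" and H: "0 \<le> H"
  shows "min_max_fair (two_values_profiles L H)
    (proportional_rule L 1 0 :: 'n::finite allocation_rule)"
  unfolding min_max_fair_def
proof
  fix \<theta> :: "real ^ 'n"
  assume \<theta>: "\<theta> \<in> two_values_profiles L H"
  define w where "w = type_weight L 1 0 \<theta>"
  define a where "a = proportional_rule L 1 0 \<theta>"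
  have a: "a \<in> allocations" unfolding a_def by (rule proportional_rule_allocation) auto
  have a_eq: "a $ i = proportional_share w i" for i
    by (simp add: a_def w_def proportional_rule_def)
  have vals: "\<theta> $ k = L \<or> \<theta> $ k = H" for k by (rule mem_two_values_profilesD[OF \<theta>])
  show "is_arg_min (\<lambda>a. MAX i. a $ i * \<theta> $ i) (\<lambda>a. a \<in> allocations) (proportional_rule L 1 0 \<theta>)"
    unfolding a_def[symmetric]
  proof (cases "\<exists>i j. \<theta> $ i = L \<and> \<theta> $ j = H")
    case True
    then obtain l h where l: "\<theta> $ l = L" and h: "\<theta> $ h = H" by blast
    have "w l \<le> sum w UNIV" by (rule member_le_sum) (auto simp: w_def type_weight_def)
    then have S: "0 < sum w UNIV" using l by (simp add: w_def type_weight_def)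
    show "is_arg_min (\<lambda>a. MAX i. a $ i * \<theta> $ i) (\<lambda>a. a \<in> allocations) a"
    proof (rule is_arg_min_max_costI[OF a])
      \<comment> \<open>Only low agents receive anything, and their costs are nonpositive. Any rival
        leaves the high agent \<open>h\<close> a cost of at least 0; this is where
        \<open>0 \<le> H\<close> enters.\<close>
      show "a $ i * \<theta> $ i \<le> 0" for i
        using vals[of i] S L LH
        by (auto simp: a_eq proportional_share_def w_def type_weight_def divide_nonpos_pos)
      show "\<exists>i. 0 \<le> b $ i * \<theta> $ i" if "b \<in> allocations" for b
        using that h H by (intro exI[of _ h]) (simp add: allocations_def)
    qed
  next
    case False
    then obtain t where t: "\<And>i. \<theta> $ i = t" using vals by metis
    \<comment> \<open>If all types are \<open>L\<close>, all weights are 1; if all are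
      \<open>H\<close>, they vanish and the default branch applies.\<close>
    have a_const: "a $ i = 1 / real CARD('n)" for i
      by (simp add: a_eq proportional_share_def w_def type_weight_def t)
    show "is_arg_min (\<lambda>a. MAX i. a $ i * \<theta> $ i) (\<lambda>a. a \<in> allocations) a"
    proof (rule is_arg_min_max_costI[OF a])
      show "a $ i * \<theta> $ i \<le> 1 / real CARD('n) * t" for i by (simp add: a_const t)
      fix b :: "real ^ 'n"
      assume b: "b \<in> allocations"
      show "\<exists>i. 1 / real CARD('n) * t \<le> b $ i * \<theta> $ i"
      \<comment> \<open>The critical agent is one receiving at least \<open>1 / CARD('n)\<close>
        when \<open>t\<close> is nonnegative, and one receiving at most that when \<open>t\<close>
        is negative.\<close>
      proof (cases "0 \<le> t")
        case True
        then show ?thesis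
          using ex_ge_of_allocations[OF a b] unfolding a_const t by (blast intro: mult_right_mono)
      next
        case False
        then have "t \<le> 0" by simp
        then show ?thesis
          using ex_ge_of_allocations[OF b a] unfolding a_const t
          by (blast intro: mult_right_mono_neg)
      qed
    qed
  qed
qed

theorem theorem23:
  fixes L H :: real
  assumes "CARD('n::finite) \<ge> 2"
    and "L < H"
    and "0 \<le> H"
  shows "\<exists>(A :: 'n allocation_rule) (p :: 'n payment_rule).
    mechanism (two_values_profiles L H) A p \<and>
    half_linear L H (two_values_profiles L H) A p \<and>
    strongly_bribeproof (two_values_profiles L H) A p \<and>
    min_max_fair (two_values_profiles L H) A"
proof -
  \<comment> \<open>The sign of \<open>L\<close> matters for fairness only: bribeproofness asks no
    more of the weights than \<open>0 \<le> y\<close> and \<open>y < x\<close>.\<close>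
  obtain x y :: real where xy: "0 \<le> y" "y < x"
    and fair: "min_max_fair (two_values_profiles L H)
      (proportional_rule L x y :: 'n allocation_rule)"
  proof (cases "0 < L")
    case True
    show thesis
      by (rule that[OF _ _ min_max_fair_inverse_weights[OF True assms(2)]])
        (use True assms(2) in \<open>auto simp: field_simps\<close>)
  next
    case False
    then have "L \<le> 0" by simp
    then show thesis
      using that[OF _ _ min_max_fair_indicator_weights[OF _ assms(2,3)]] by simp
  qed
  let ?A = "proportional_rule L x y :: 'n allocation_rule"
  have "mechanism (two_values_profiles L H) ?A (half_linear_payment L H ?A)"
    by (simp add: mechanism_def proportional_rule_allocation xy)
  then show ?thesis
    using half_linear_half_linear_payment strongly_bribeproof_proportional_rule[OF assms(2) xy]
      fair by blast
qed

end
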